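(* Let $\Lambda$ be a $\sigma$-compact metric space, let $\sigma$ be a positive diffuse Radon measure on $\Lambda$, and let $\mu_\sigma$ be the Poisson measure of intensity $\sigma$ on the configuration space $\Gamma_\Lambda$. Given any fixed configuration $\eta\in\Gamma_\Lambda$ and provided the intensity measure $\sigma$ is finite, we have for any $r>0$: $$\mu_\sigma\big(\rho_\eta\ge\mathbb{E}_{\mu_\sigma}[\rho_\eta]+r\big)\le\frac{\sqrt{2\pi[\sigma(\Lambda)]}\,[\sigma(\Lambda)]^{[\sigma(\Lambda)]}\,e^{\frac{1}{12[\sigma(\Lambda)]}}}{\sigma(\Lambda)^{\sigma(\Lambda)}}\;\frac{\exp\left\{[\sigma(\Lambda)+r]-[\sigma(\Lambda)]-[\sigma(\Lambda)+r]\log\left(\frac{[\sigma(\Lambda)+r]}{[\sigma(\Lambda)+r]-r}\right)\right\}}{\sqrt{2\pi[\sigma(\Lambda)+r]}},$$ where $\rho_\eta=\rho_1(\cdot,\eta)$ denotes the total variation distance to $\eta$.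
   Context: For a positive real number $R$, $[R]=\inf\{N\in\{1,2,3,\dots\}:N\ge R\}$ denotes the upper integer part of $R$. $\Gamma_\Lambda=\{\omega\subset\Lambda : \omega\cap K \text{ is a finite set for every compact } K\subset\Lambda\}$ is the configuration space, with $\omega$ identified with the positive Radon measure $\sum_{x\in\omega}\varepsilon_x$ (where $\varepsilon_x$ is the Dirac measure at $x$). It carries the vague topology and the corresponding Borel $\sigma$-algebra. The Poisson measure $\mu_\sigma$ is the probability measure on $\Gamma_\Lambda$ characterized by $\mathbb{E}_{\mu_\sigma}[\exp(\int_\Lambda f\,d\omega)]=\exp\{\int_\Lambda(e^f-1)\,d\sigma\}$ for all continuous compactly supported $f$ on $\Lambda$; $\mathbb{E}_{\mu_\sigma}$ denotes expectation under $\mu_\sigma$. The total variation distance on $\Gamma_\Lambda$ is $\rho_1(\omega,\eta)=\sum_{x\in\Lambda}|\omega(\{x\})-\eta(\{x\})|$, i.e. the number of different atoms between the two configurations; configurations may be infinite and $\rho_1$ may take infinite values.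
   Formalization: The formal theorem additionally assumes that the expectation of ρ_η under μ_σ is finite; for an infinite configuration η (e.g. the integers, with σ Gaussian on the line) ρ_η and its mean are infinite and the inequality fails for large r. *)

theory Defs
  imports "HOL-Probability.Probability"
begin

text \<open>The space \<open>\<Lambda>\<close> is the whole type \<open>'a :: metric_space\<close>. Local compactness is not assumed.\<close>

definition sigma_compact_space :: "'a::topological_space itself \<Rightarrow> bool" where
  "sigma_compact_space _ \<longleftrightarrow>
     (\<exists>K :: nat \<Rightarrow> 'a set. (\<forall>n. compact (K n)) \<and> (\<Union>n. K n) = UNIV)"

definition radon_measure :: "'a::topological_space measure \<Rightarrow> bool" where
  "radon_measure \<sigma> \<longleftrightarrow>
     sets \<sigma> = sets borel \<and>
     (\<forall>K. compact K \<longrightarrow> emeasure \<sigma> K < \<infinity>) \<and>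
     (\<forall>B\<in>sets borel. emeasure \<sigma> B = (SUP K\<in>{K. compact K \<and> K \<in> sets borel \<and> K \<subseteq> B}. emeasure \<sigma> K))"

definition diffuse :: "'a measure \<Rightarrow> bool" where
  "diffuse \<sigma> \<longleftrightarrow> (\<forall>x. emeasure \<sigma> {x} = 0)"

text \<open>The upper integer part is at least 1, so it differs from the ceiling at 0.\<close>

definition upper_int :: "real \<Rightarrow> nat" where
  "upper_int R = Inf {N. 1 \<le> N \<and> R \<le> real N}"

definition configurations :: "'a::topological_space set set" where
  "configurations = {\<omega>. \<forall>K. compact K \<longrightarrow> finite (\<omega> \<inter> K)}"

text \<open>The measure \<open>\<Sum>x\<in>\<omega>. \<epsilon>\<^sub>x\<close>, obtained as the push-forward to the Borel \<open>\<sigma>\<close>-algebra of the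
  counting measure on \<open>\<omega>\<close>; the next lemma states the description as a sum of Dirac measures.\<close>

definition config_measure :: "'a::topological_space set \<Rightarrow> 'a measure" where
  "config_measure \<omega> = distr (count_space \<omega>) borel (\<lambda>x. x)"

lemma emeasure_config_measure:
  assumes "B \<in> sets borel"
  shows "emeasure (config_measure \<omega>) B = (\<integral>\<^sup>+x. emeasure (return borel x) B \<partial>count_space \<omega>)"
proof -
  have "emeasure (config_measure \<omega>) B = emeasure (count_space \<omega>) (\<omega> \<inter> B)"
    unfolding config_measure_def using assms by (subst emeasure_distr) (auto simp: Int_commute)
  also have "\<dots> = (\<integral>\<^sup>+x. indicator (\<omega> \<inter> B) x \<partial>count_space \<omega>)"
    by (rule nn_integral_indicator[symmetric]) auto
  also have "\<dots> = (\<integral>\<^sup>+x. emeasure (return borel x) B \<partial>count_space \<omega>)"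
    using assms by (intro nn_integral_cong) (auto simp: indicator_def)
  finally show ?thesis .
qed

definition compactly_supported_continuous :: "('a::topological_space \<Rightarrow> real) set" where
  "compactly_supported_continuous =
     {f. continuous_on UNIV f \<and> compact (closure {x. f x \<noteq> 0})}"

text \<open>The coarsest topology on configurations making \<open>\<omega> \<mapsto> \<integral> f d\<omega>\<close> continuous for every
  continuous compactly supported \<open>f\<close>.\<close>

definition vague_topology :: "'a::topological_space set topology" where
  "vague_topology = topology_generated_by
     {{\<omega> \<in> configurations. (\<integral>x. f x \<partial>config_measure \<omega>) \<in> U} | f U.
        f \<in> compactly_supported_continuous \<and> open U}"

definition config_algebra :: "'a::topological_space set measure" where
  "config_algebra = sigma configurations {U. openin vague_topology U}"

definition poisson_measure :: "'a::topological_space measure \<Rightarrow> 'a set measure \<Rightarrow> bool" where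
  "poisson_measure \<sigma> \<mu> \<longleftrightarrow>
     prob_space \<mu> \<and> sets \<mu> = sets config_algebra \<and>
     (\<forall>f\<in>compactly_supported_continuous.
        (\<integral>\<omega>. exp (\<integral>x. f x \<partial>config_measure \<omega>) \<partial>\<mu>) = exp (\<integral>x. exp (f x) - 1 \<partial>\<sigma>))"

definition total_variation :: "'a::topological_space set \<Rightarrow> 'a set \<Rightarrow> ennreal" where
  "total_variation \<omega> \<eta> =
     (\<Sum>\<^sub>\<infinity>x\<in>UNIV. ennreal \<bar>measure (config_measure \<omega>) {x} - measure (config_measure \<eta>) {x}\<bar>)"

lemma topspace_vague_topology: "topspace vague_topology = configurations"
proof -
  have "(\<lambda>_. 0 :: real) \<in> compactly_supported_continuous"
    by (simp add: compactly_supported_continuous_def)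
  then have "configurations \<in>
     {{\<omega> \<in> configurations. (\<integral>x. f x \<partial>config_measure \<omega>) \<in> U} | f U.
        f \<in> compactly_supported_continuous \<and> open U}"
    by (intro CollectI exI[of _ "\<lambda>_. 0"] exI[of _ UNIV]) auto
  then show ?thesis unfolding vague_topology_def topology_generated_by_topspace by blast
qed

lemma space_config_algebra: "space config_algebra = configurations"
  by (simp add: config_algebra_def space_measure_of_conv)

end

theory Submission
  imports Defs
begin

text \<open>
  The total variation distance \<open>\<rho>\<^sub>\<eta>(\<omega>)\<close> counts the points of the symmetric difference of \<open>\<omega>\<close> and \<open>\<eta>\<close>.
  For a diffuse intensity a Poisson configuration almost surely avoids the countably many points of
  \<open>\<eta>\<close>, so \<open>\<rho>\<^sub>\<eta>(\<omega>) = \<bar>\<omega>\<bar> + \<bar>\<eta>\<bar>\<close> and the deviation of \<open>\<rho>\<^sub>\<eta>\<close> above its mean is the deviation of the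
  Poisson variable \<open>\<bar>\<omega>\<bar>\<close> above its mean.

  A Poisson variable \<open>N\<close> of mean \<open>t\<close> has factorial moments
  \<open>E[N (N - 1) \<dots> (N - d + 1)] = t\<^sup>d\<close> (\<open>poisson_factorial_moment\<close>), and Markov's inequality for
  them gives \<open>P(N \<ge> k) \<le> t\<^sup>d (k - d)! / k!\<close> for every \<open>d \<le> k\<close>
  (\<open>poisson_tail_le_factorial_moment\<close>). Write \<open>s\<close> for the total mass, \<open>m = [s]\<close> and \<open>n = [s + r]\<close>.
  With \<open>k = n\<close> and \<open>d = n - m\<close> the estimate reads \<open>P(N \<ge> n) \<le> t\<^sup>d m! / n!\<close> (if \<open>n - r < 1\<close>, the
  order \<open>d = n\<close> is taken instead), and
  Stirling's formula for the quotient \<open>m! / n!\<close> turns this into the bound claimed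
  (\<open>poisson_moment_bound_le_stirling_bound\<close>). Only a quotient of factorials occurs, so the constant
  \<open>sqrt (2 \<pi>)\<close> of Stirling's formula cancels.

  Since \<open>\<Lambda>\<close> may fail to be locally compact, continuous functions of compact support may all vanish
  on a large part of \<open>\<Lambda>\<close>. They detect exactly the points of the open set \<open>V\<close> called
  \<open>visible_region\<close> below, and every event depends on \<open>\<omega> \<inter> V\<close> alone (\<open>config_event_visible_cong\<close>).
  The Poisson property is thus a statement about \<open>\<omega> \<inter> V\<close>, whose number of points is Poisson of mean
  \<open>t = \<sigma>(V) \<le> s\<close>, while \<open>\<rho>\<^sub>\<eta>\<close> need not be measurable and its integral is a lower integral. Two
  observations reduce this to the situation above. First, \<open>\<rho>\<^sub>\<eta>(\<omega>) \<ge> \<bar>\<omega> \<inter> V\<bar> + \<bar>\<eta> \<inter> V\<bar>\<close> almost surely,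
  whence the mean is at least \<open>t + \<bar>\<eta> \<inter> V\<bar>\<close>. Second, if the deviation event is measurable, then
  membership of \<open>\<omega>\<close> does not change when the part of \<open>\<omega>\<close> outside \<open>V\<close> is replaced by that of \<open>\<eta>\<close>; the
  distance of the new configuration to \<open>\<eta>\<close> is at most \<open>\<bar>\<omega> \<inter> V\<bar> + \<bar>\<eta> \<inter> V\<bar>\<close>, so that
  \<open>\<bar>\<omega> \<inter> V\<bar> \<ge> t + r\<close>. As \<open>t\<close> may be smaller than \<open>s\<close>, the numerical comparison has to be uniform in
  \<open>0 \<le> t \<le> s\<close>.
\<close>

section \<open>Stirling quotient bounds\<close>

text \<open>The difference of the two sides vanishes at \<open>1\<close> and has derivative
  \<open>(y - 1)\<^sup>4 / (6 y\<^sup>2 (y + 1)\<^sup>2)\<close>. At \<open>y = 1 + 1 / k\<close> the bound becomes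
  \<open>(k + 1 / 2) ln (1 + 1 / k) \<le> 1 + 1 / (12 k (k + 1))\<close>, the step of Stirling's estimate.\<close>

lemma ln_le_rational:
  fixes y :: real
  assumes "1 \<le> y"
  shows "ln y \<le> (y + 8 - 1 / y - 16 / (y + 1)) / 6"
proof -
  define g where "g y = (y + 8 - 1 / y - 16 / (y + 1)) / 6 - ln y" for y :: real
  have "g 1 \<le> g y"
  proof (rule DERIV_nonneg_imp_nondecreasing[OF assms])
    fix x :: real assume x: "1 \<le> x" "x \<le> y"
    have "(g has_real_derivative (1 + 1 / x^2 + 16 / (x + 1)^2) / 6 - 1 / x) (at x)"
      unfolding g_def using x
      by (auto intro!: derivative_eq_intros simp: power2_eq_square field_simps)
    moreover have "(1 + 1 / x^2 + 16 / (x + 1)^2) / 6 - 1 / x = (x - 1)^4 / (6 * x^2 * (x + 1)^2)"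
    proof -
      have "x \<noteq> 0" "x + 1 \<noteq> 0" using x by auto
      then show ?thesis by (simp add: divide_simps) (simp add: power4_eq_xxxx power2_eq_square algebra_simps)
    qed
    ultimately show "\<exists>z. (g has_real_derivative z) (at x) \<and> 0 \<le> z"
      by (metis divide_nonneg_nonneg mult_nonneg_nonneg zero_le_even_power even_numeral zero_le_numeral)
  qed
  then show ?thesis by (simp add: g_def)
qed

text \<open>The logarithm of \<open>n! / (sqrt n (n / e)\<^sup>n)\<close>, which decreases to \<open>ln (sqrt (2 \<pi>))\<close>.\<close>

definition stirling_defect :: "nat \<Rightarrow> real" where
  "stirling_defect n = ln (fact n) - (real n + 1 / 2) * ln (real n) + real n"

lemma stirling_defect_step:
  assumes "1 \<le> k"
  shows "stirling_defect k - stirling_defect (Suc k) \<le> 1 / (12 * real k) - 1 / (12 * real (Suc k))"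
proof -
  have k: "real k > 0" using assms by simp
  have "(real k + 1 / 2) * ln (real (Suc k) / real k) \<le>
    (real k + 1 / 2) * ((real (Suc k) / real k + 8 - 1 / (real (Suc k) / real k) - 16 / (real (Suc k) / real k + 1)) / 6)"
    using k by (intro mult_left_mono ln_le_rational) auto
  also have "\<dots> = 1 + (1 / (12 * real k) - 1 / (12 * real (Suc k)))"
  proof -
    have "1 + real k \<noteq> 0" "real k \<noteq> 0" "real k + (1 + real k) \<noteq> 0" "1 + 2 * real k \<noteq> 0" using k by linarith+
    then show ?thesis
      by (simp add: divide_simps add.commute) (simp add: algebra_simps power2_eq_square)
  qed
  finally have *: "(real k + 1 / 2) * ln (real (Suc k) / real k) \<le> 1 + (1 / (12 * real k) - 1 / (12 * real (Suc k)))" .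
  have "stirling_defect k - stirling_defect (Suc k) = (real k + 1 / 2) * ln (real (Suc k) / real k) - 1"
  proof -
    have "ln (fact (Suc k) :: real) = ln (real (Suc k)) + ln (fact k)"
      unfolding fact_Suc using k by (simp add: ln_mult del: of_nat_Suc)
    then show ?thesis
      using k unfolding stirling_defect_def by (simp add: ln_div algebra_simps)
  qed
  with * show ?thesis by linarith
qed

text \<open>The bounds on the single steps telescope.\<close>

lemma stirling_defect_le:
  assumes "1 \<le> m" "m \<le> n"
  shows "stirling_defect m - stirling_defect n \<le> 1 / (12 * real m)"
proof -
  have "stirling_defect m - stirling_defect n \<le> 1 / (12 * real m) - 1 / (12 * real n)"
    using assms(2)
  proof (induction n rule: dec_induct)
    case (step k)
    with stirling_defect_step[of k] assms show ?case by linarith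
  qed simp
  also have "\<dots> \<le> 1 / (12 * real m)" by simp
  finally show ?thesis .
qed

text \<open>The factors \<open>sqrt (2 \<pi>)\<close> on the right cancel; they are kept to match the usual form of
  Stirling's approximation of \<open>m!\<close> and \<open>n!\<close>.\<close>

lemma fact_ratio_le_stirling:
  assumes "1 \<le> m" "m \<le> n"
  shows "fact m / fact n \<le>
    sqrt (2 * pi * real m) * real m ^ m * exp (1 / (12 * real m)) *
      (exp (real n - real m) / real n ^ n / sqrt (2 * pi * real n))"
proof -
  have pos: "real m > 0" "real n > 0" using assms by auto
  have half: "exp (ln x / 2) = sqrt x" if "x > 0" for x :: real
    using that by (simp flip: ln_sqrt)
  have pow: "exp (real k * ln (real k)) = real k ^ k" if "real k > 0" for k
    using that by (simp add: exp_of_nat_mult)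
  have f: "fact k = exp (stirling_defect k) * sqrt (real k) * real k ^ k / exp (real k)" if "real k > 0" for k
  proof -
    have "(fact k :: real) = exp (ln (fact k))" by simp
    also have "ln (fact k) = stirling_defect k + ln (real k) / 2 + real k * ln (real k) - real k"
      by (simp add: stirling_defect_def algebra_simps)
    also have "exp \<dots> = exp (stirling_defect k) * sqrt (real k) * real k ^ k / exp (real k)"
      using that by (simp only: exp_add exp_diff half pow)
    finally show ?thesis .
  qed
  have "fact m / fact n = exp (stirling_defect m - stirling_defect n) *
      (sqrt (real m) * real m ^ m * (exp (real n - real m) / real n ^ n / sqrt (real n)))"
    unfolding f[OF pos(1)] f[OF pos(2)] exp_diff by (simp add: divide_inverse mult_ac)
  also have "\<dots> \<le> exp (1 / (12 * real m)) *
      (sqrt (real m) * real m ^ m * (exp (real n - real m) / real n ^ n / sqrt (real n)))"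
    using stirling_defect_le[OF assms] by (intro mult_right_mono) auto
  also have "\<dots> = sqrt (2 * pi * real m) * real m ^ m * exp (1 / (12 * real m)) *
      (exp (real n - real m) / real n ^ n / sqrt (2 * pi * real n))"
  proof -
    have "sqrt (2 * pi * x) = sqrt (2 * pi) * sqrt x" for x by (rule real_sqrt_mult)
    moreover have "sqrt (2 * pi) \<noteq> 0" by simp
    ultimately show ?thesis by simp
  qed
  finally show ?thesis .
qed

section \<open>Comparison of the moment bound with the Stirling bound\<close>

lemma upper_int_eq: "upper_int R = max 1 (nat \<lceil>R\<rceil>)"
proof -
  have "{N. 1 \<le> N \<and> R \<le> real N} = {max 1 (nat \<lceil>R\<rceil>)..}"
    by (auto simp: nat_le_iff ceiling_le_iff)
  then show ?thesis by (simp add: upper_int_def)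
qed

text \<open>Both sides are products over \<open>i < d\<close>, and they are compared factor by factor: since
  \<open>i \<le> d - 1 < r\<close>, the quotient \<open>(k - r) / (k - i)\<close> grows with \<open>k\<close>. This is what makes the Poisson
  tail bound uniform in means smaller than the total mass.\<close>

lemma falling_factorial_quotient_mono:
  fixes t r :: real and k n d :: nat
  assumes "0 \<le> t" "t \<le> real k - r" "k \<le> n" "d \<le> k" "real d < r + 1"
  shows "t ^ d / (fact d * real (k choose d)) \<le> (real n - r) ^ d * fact (n - d) / fact n"
proof -
  have ff: "fact d * real (j choose d) = (\<Prod>i<d. real j - real i)" for j
    by (simp add: binomial_gbinomial gbinomial_mult_fact lessThan_atLeast0)
  have "t ^ d / (fact d * real (k choose d)) = (\<Prod>i<d. t / (real k - real i))"
    by (simp add: ff prod_dividef)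
  also have "\<dots> \<le> (\<Prod>i<d. (real n - r) / (real n - real i))"
  proof (intro prod_mono conjI)
    fix i assume i: "i \<in> {..<d}"
    then have p: "real k - real i > 0" "real n - real i > 0" using assms by auto
    then show "0 \<le> t / (real k - real i)" using assms by simp
    have "t / (real k - real i) \<le> (real k - r) / (real k - real i)"
      using p assms by (intro divide_right_mono) auto
    also have "\<dots> \<le> (real n - r) / (real n - real i)"
    proof -
      have "real i \<le> r" using i assms(5) by auto
      then have "(real n - real k) * (real i - r) \<le> 0"
        using assms by (intro mult_nonneg_nonpos) auto
      then show ?thesis using p by (simp add: divide_simps) (simp add: algebra_simps)
    qed
    finally show "t / (real k - real i) \<le> (real n - r) / (real n - real i)" .
  qed
  also have "\<dots> = (real n - r) ^ d / (fact d * real (n choose d))"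
    by (simp add: ff prod_dividef)
  also have "\<dots> = (real n - r) ^ d * fact (n - d) / fact n"
    using assms by (simp add: binomial_fact field_simps)
  finally show ?thesis .
qed

text \<open>If \<open>n - r \<ge> 1\<close>, the moment of order \<open>d = n - m\<close> suffices, because
  \<open>s powr s \<le> (n - r)\<^sup>m\<close> by \<open>s \<le> n - r\<close> and \<open>s \<le> m\<close>. If \<open>n - r < 1\<close>, this comparison can fail, but
  then \<open>s < 1\<close>, \<open>m = 1\<close> and \<open>k = n\<close>, and the moment of the largest order \<open>d = n\<close> does it because
  \<open>s powr s \<le> 1\<close>. For \<open>s = 0\<close> the right-hand side is \<open>0\<close> by the convention \<open>0 powr 0 = 0\<close> and
  division by zero; then \<open>t = 0\<close>, and the first moment shows that \<open>p \<le> 0\<close>.\<close>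

lemma poisson_moment_bound_le_stirling_bound:
  fixes s t r p :: real and k :: nat
  defines "m \<equiv> upper_int s" and "n \<equiv> upper_int (s + r)"
  assumes t: "0 \<le> t" "t \<le> s" and r: "0 < r" and k: "k = nat \<lceil>t + r\<rceil>"
    and p: "\<And>d. d \<le> k \<Longrightarrow> p \<le> t ^ d / (fact d * real (k choose d))"
  shows "p \<le> (sqrt (2 * pi * real m) * real m ^ m * exp (1 / (12 * real m))) / (s powr s) *
       (exp (real n - real m - real n * ln (real n / (real n - r))) / sqrt (2 * pi * real n))"
proof (cases "s = 0")
  case True
  with t have "t = 0" by simp
  moreover have "1 \<le> k" using t r unfolding k by linarith
  ultimately have "p \<le> 0" using p[of 1] by simp
  with True show ?thesis by simp
next
  case False
  with t have s: "s > 0" by simp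
  have kb: "t + r \<le> real k" "real k < t + r + 1" using t r unfolding k by linarith+
  have n1: "n = nat \<lceil>s + r\<rceil>" unfolding n_def upper_int_eq using s r by linarith
  have m1: "m = nat \<lceil>s\<rceil>" unfolding m_def upper_int_eq using s by linarith
  have nb: "s + r \<le> real n" "real n < s + r + 1" using s r unfolding n1 by linarith+
  have mb: "s \<le> real m" "real m < s + 1" "1 \<le> m" using s unfolding m1 by linarith+
  have kn: "k \<le> n" unfolding k n1 using t by (intro nat_mono ceiling_mono) auto
  have mn: "m \<le> n" unfolding m1 n1 using r by (intro nat_mono ceiling_mono) auto
  have q: "real n - r > 0" using nb s by simp
  have main: "p \<le> fact m / fact n * ((real n - r) ^ n / s powr s)"
  proof (cases "1 \<le> real n - r")
    case True
    define d where "d = n - m"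
    have d: "d \<le> n" "n - d = m" "real d = real n - real m" using mn by (auto simp: d_def of_nat_diff)
    \<comment> \<open>Needed for the monotone comparison; it follows from \<open>n < s + r + 1\<close> and \<open>s \<le> m\<close>.\<close>
    have dr: "real d < r + 1" using d nb mb by linarith
    have "d \<le> k" using dr kb t by linarith
    have "p \<le> (real n - r) ^ d * fact (n - d) / fact n"
      using p[OF \<open>d \<le> k\<close>] falling_factorial_quotient_mono[OF t(1) _ kn \<open>d \<le> k\<close> dr] kb
      by fastforce
    also have "\<dots> = fact m / fact n * (real n - r) ^ d" using d by simp
    also have "\<dots> \<le> fact m / fact n * ((real n - r) ^ n / s powr s)"
    proof -
      have "s powr s \<le> (real n - r) powr s" using s nb by (intro powr_mono2) auto
      also have "\<dots> \<le> (real n - r) powr real m" using True mb by (intro powr_mono) auto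
      also have "\<dots> = (real n - r) ^ m" using q by (simp add: powr_realpow)
      finally have "(real n - r) ^ d * s powr s \<le> (real n - r) ^ d * (real n - r) ^ m"
        using q by (intro mult_left_mono) auto
      also have "\<dots> = (real n - r) ^ n" using mn by (simp add: d_def flip: power_add)
      finally show ?thesis using s by (intro mult_left_mono) (auto simp: pos_le_divide_eq)
    qed
    finally show ?thesis .
  next
    case False
    then have "s < 1" using nb by simp
    have "m = 1" using mb \<open>s < 1\<close> by linarith
    \<comment> \<open>Otherwise \<open>k \<le> n - 1\<close>, and \<open>r \<le> k\<close> would give \<open>n - r \<ge> 1\<close>.\<close>
    have "k = n" using False kb kn t by linarith
    have "s powr s \<le> 1" using s \<open>s < 1\<close> powr_mono2[of s s 1] by simp
    have "p \<le> t ^ n / fact n" using p[of n] \<open>k = n\<close> by simp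
    also have "\<dots> \<le> (real n - r) ^ n / fact n"
      using t nb by (intro divide_right_mono power_mono) auto
    also have "\<dots> \<le> (real n - r) ^ n / s powr s / fact n"
      using \<open>s powr s \<le> 1\<close> s q 
      by (intro divide_right_mono) (auto simp: pos_le_divide_eq intro!: mult_left_le)
    finally show ?thesis by (simp add: \<open>m = 1\<close> mult.commute)
  qed
  have npos: "real n > 0" using mn mb by linarith
  have e: "exp (real n - real m - real n * ln (real n / (real n - r))) =
      exp (real n - real m) / real n ^ n * (real n - r) ^ n"
  proof -
    have "exp (real n * ln (real n / (real n - r))) = (real n / (real n - r)) ^ n"
      using npos q by (simp add: exp_of_nat_mult)
    then show ?thesis unfolding exp_diff[of "real n - real m"] by (simp add: power_divide)
  qed
  have "fact m / fact n * ((real n - r) ^ n / s powr s) \<le>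
    sqrt (2 * pi * real m) * real m ^ m * exp (1 / (12 * real m)) *
      (exp (real n - real m) / real n ^ n / sqrt (2 * pi * real n)) * ((real n - r) ^ n / s powr s)"
    using q by (intro mult_right_mono fact_ratio_le_stirling mb mn) auto
  also have "\<dots> = (sqrt (2 * pi * real m) * real m ^ m * exp (1 / (12 * real m))) / (s powr s) *
       (exp (real n - real m - real n * ln (real n / (real n - r))) / sqrt (2 * pi * real n))"
    unfolding e by (simp add: mult_ac)
  finally show ?thesis using main by linarith
qed

section \<open>Factorial moments of Poisson variables\<close>

text \<open>A generating function is known only for positive arguments. After removal of the vanishing
  lower coefficients, the next coefficient is the limit at \<open>0\<close> of a power series, and the limit from
  the right determines it.\<close>

lemma powser_zero_right_imp_coeff_zero:
  fixes c :: "nat \<Rightarrow> real"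
  assumes sums: "\<And>u. 0 < u \<Longrightarrow> u < 1 \<Longrightarrow> (\<lambda>n. c n * u ^ n) sums 0"
  shows "c k = 0"
proof (induction k rule: less_induct)
  case (less k)
  \<comment> \<open>The series divided by \<open>u ^ k\<close>, its lower coefficients being zero by induction.\<close>
  define b where "b n = c (n + k)" for n
  have b: "(\<lambda>n. b n * u ^ n) sums 0" if "0 < u" "u < 1" for u
  proof -
    have "(\<lambda>n. c (n + k) * u ^ (n + k)) sums (0 - (\<Sum>i<k. c i * u ^ i))"
      using sums_split_initial_segment[OF sums[OF that]] .
    then have "(\<lambda>n. c (n + k) * u ^ (n + k) / u ^ k) sums ((0 - (\<Sum>i<k. c i * u ^ i)) / u ^ k)"
      by (rule sums_divide)
    then show ?thesis using less.IH that by (simp add: b_def power_add)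
  qed
  have "(\<lambda>n. b n * x ^ n) sums suminf (\<lambda>n. b n * x ^ n)" if "norm x < 1 / 2" for x
    using powser_inside[of b "1/2" x] sums_summable[OF b[of "1/2"]] that
    by (intro summable_sums) auto
  then have "((\<lambda>x. suminf (\<lambda>n. b n * x ^ n)) \<longlongrightarrow> b 0) (at 0)"
    by (intro powser_limit_0[of "1/2"]) auto
  then have "((\<lambda>x. suminf (\<lambda>n. b n * x ^ n)) \<longlongrightarrow> b 0) (at_right 0)"
    by (rule filterlim_mono) (auto intro: at_le)
  moreover have "\<forall>\<^sub>F x in at_right 0. suminf (\<lambda>n. b n * x ^ n) = 0"
    using eventually_at_right_real[of 0 1]
    by (auto elim!: eventually_mono intro!: sums_unique[symmetric] b)
  ultimately have "((\<lambda>x::real. 0) \<longlongrightarrow> b 0) (at_right 0)"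
    by (rule Lim_transform_eventually)
  then have "b 0 = 0" using tendsto_unique[OF trivial_limit_at_right_real _ tendsto_const] by blast
  then show ?case by (simp add: b_def)
qed

text \<open>By the binomial theorem \<open>E[(1 + u)\<^sup>X] = \<Sum>d. E[X choose d] u\<^sup>d\<close>, and the coefficients are
  compared with those of \<open>exp (t u)\<close>.\<close>

lemma poisson_factorial_moment:
  fixes X :: "'b \<Rightarrow> nat" and t :: real
  assumes X [measurable]: "X \<in> measurable M (count_space UNIV)"
    and gf: "\<And>u. 0 < u \<Longrightarrow> (\<integral>\<^sup>+x. ennreal ((1 + u) ^ X x) \<partial>M) = ennreal (exp (t * u))"
  shows "(\<integral>\<^sup>+x. ennreal (real (X x choose d)) \<partial>M) = ennreal (t ^ d / fact d)"
proof -
  define a where "a d = (\<integral>\<^sup>+x. ennreal (real (X x choose d)) \<partial>M)" for d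
  have sum_a: "(\<Sum>d. a d * ennreal (u ^ d)) = ennreal (exp (t * u))" if u: "0 < u" for u
  proof -
    have "ennreal (exp (t * u)) = (\<integral>\<^sup>+x. (\<Sum>d. ennreal (real (X x choose d) * u ^ d)) \<partial>M)"
      unfolding gf[OF u, symmetric]
    proof (rule nn_integral_cong)
      fix x
      have "(\<Sum>d. ennreal (real (X x choose d) * u ^ d)) = (\<Sum>d\<le>X x. ennreal (real (X x choose d) * u ^ d))"
        by (intro suminf_finite) (auto simp: binomial_eq_0)
      also have "\<dots> = ennreal (\<Sum>d\<le>X x. real (X x choose d) * u ^ d)"
        using u by (intro sum_ennreal) auto
      also have "(\<Sum>d\<le>X x. real (X x choose d) * u ^ d) = (1 + u) ^ X x"
        using binomial_ring[of u 1 "X x"] by (simp add: add.commute)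
      finally show "ennreal ((1 + u) ^ X x) = (\<Sum>d. ennreal (real (X x choose d) * u ^ d))" by simp
    qed
    also have "\<dots> = (\<Sum>d. \<integral>\<^sup>+x. ennreal (real (X x choose d) * u ^ d) \<partial>M)"
      by (intro nn_integral_suminf) auto
    also have "\<dots> = (\<Sum>d. a d * ennreal (u ^ d))"
      using u by (simp add: a_def ennreal_mult nn_integral_multc)
    finally show ?thesis by simp
  qed
  have fin: "a d < \<infinity>" for d
  proof -
    have "a d * ennreal (1 ^ d) \<le> (\<Sum>d. a d * ennreal (1 ^ d))"
      using sum_le_suminf[of "\<lambda>d. a d * ennreal (1 ^ d)" "{d}"] by simp
    also have "\<dots> < \<infinity>" using sum_a[of 1] by simp
    finally show ?thesis by simp
  qed
  define b where "b d = enn2real (a d)" for d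
  have ab: "a d = ennreal (b d)" and b0: "0 \<le> b d" for d
    using fin by (auto simp: b_def less_top)
  have "(\<lambda>d. (b d - t ^ d / fact d) * u ^ d) sums 0" if u: "0 < u" for u
  proof -
    have eq: "(\<Sum>d. ennreal (b d * u ^ d)) = ennreal (exp (t * u))"
      using sum_a[OF u] u b0 by (simp add: ab ennreal_mult)
    then have s: "summable (\<lambda>d. b d * u ^ d)"
      using u b0 by (intro summable_suminf_not_top) auto
    have "0 \<le> (\<Sum>d. b d * u ^ d)" using s u b0 by (intro suminf_nonneg) auto
    moreover have "ennreal (\<Sum>d. b d * u ^ d) = ennreal (exp (t * u))"
      using eq s u b0 by (subst (asm) suminf_ennreal2) auto
    ultimately have "(\<Sum>d. b d * u ^ d) = exp (t * u)" by simp
    then have "(\<lambda>d. b d * u ^ d) sums exp (t * u)"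
      using s by (simp add: sums_iff)
    moreover have "(\<lambda>d. t ^ d / fact d * u ^ d) sums exp (t * u)"
      using exp_converges[of "t * u"] by (simp add: power_mult_distrib divide_inverse mult_ac)
    ultimately have "(\<lambda>d. b d * u ^ d - t ^ d / fact d * u ^ d) sums (exp (t * u) - exp (t * u))"
      by (rule sums_diff)
    then show ?thesis by (simp add: left_diff_distrib)
  qed
  then have "b d - t ^ d / fact d = 0" by (rule powser_zero_right_imp_coeff_zero)
  then show ?thesis using ab[of d] by (simp add: a_def)
qed

text \<open>Markov's inequality for \<open>X choose d\<close>, which is monotone in \<open>X\<close>.\<close>

lemma poisson_tail_le_factorial_moment:
  fixes X :: "'b \<Rightarrow> nat" and t :: real
  assumes M: "prob_space M" and X [measurable]: "X \<in> measurable M (count_space UNIV)"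
    and gf: "\<And>u. 0 < u \<Longrightarrow> (\<integral>\<^sup>+x. ennreal ((1 + u) ^ X x) \<partial>M) = ennreal (exp (t * u))"
    and t: "0 \<le> t" and d: "d \<le> k"
  shows "measure M {x \<in> space M. k \<le> X x} \<le> t ^ d / (fact d * real (k choose d))"
proof -
  interpret prob_space M by fact
  let ?A = "{x \<in> space M. k \<le> X x}"
  have "ennreal (real (k choose d)) * emeasure M ?A =
      (\<integral>\<^sup>+x. ennreal (real (k choose d)) * indicator ?A x \<partial>M)"
    by (rule nn_integral_cmult_indicator[symmetric]) measurable
  also have "\<dots> \<le> (\<integral>\<^sup>+x. ennreal (real (X x choose d)) \<partial>M)"
    by (intro nn_integral_mono) (auto simp: indicator_def intro!: binomial_right_mono)
  also have "\<dots> = ennreal (t ^ d / fact d)"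
    by (rule poisson_factorial_moment[OF X gf])
  finally have "ennreal (real (k choose d) * prob ?A) \<le> ennreal (t ^ d / fact d)"
    by (simp add: emeasure_eq_measure ennreal_mult)
  then have "real (k choose d) * prob ?A \<le> t ^ d / fact d"
    using t by (subst (asm) ennreal_le_iff) auto
  moreover have "0 < real (k choose d)" using d by simp
  ultimately show ?thesis by (simp add: field_simps)
qed

section \<open>Test functions and events of configurations\<close>

lemma compactly_supported_continuousI:
  fixes f :: "'a::t2_space \<Rightarrow> real"
  assumes "continuous_on UNIV f" "compact K" "{x. f x \<noteq> 0} \<subseteq> K"
  shows "f \<in> compactly_supported_continuous"
proof -
  have "closure {x. f x \<noteq> 0} \<subseteq> K"
    using assms compact_imp_closed closure_minimal by metis
  then have "compact (K \<inter> closure {x. f x \<noteq> 0})" "K \<inter> closure {x. f x \<noteq> 0} = closure {x. f x \<noteq> 0}"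
    using assms by (auto intro!: compact_Int_closed)
  then show ?thesis using assms by (simp add: compactly_supported_continuous_def)
qed

lemma compactly_supported_continuous_scaled:
  fixes f :: "'a::t2_space \<Rightarrow> real"
  assumes "f \<in> compactly_supported_continuous"
  shows "(\<lambda>x. c * f x) \<in> compactly_supported_continuous"
  using assms
  by (intro compactly_supported_continuousI[where K = "closure {x. f x \<noteq> 0}"])
     (auto simp: compactly_supported_continuous_def intro!: continuous_intros closure_subset[THEN subsetD])

lemma finite_support_in_configuration:
  assumes "f \<in> compactly_supported_continuous" "\<omega> \<in> configurations"
  shows "finite {x \<in> \<omega>. f x \<noteq> 0}"
proof -
  have "finite (\<omega> \<inter> closure {x. f x \<noteq> 0})"
    using assms by (auto simp: compactly_supported_continuous_def configurations_def)
  then show ?thesis by (rule finite_subset[rotated]) (auto intro: subsetD[OF closure_subset])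
qed

text \<open>The sum is finite because the support of \<open>f\<close> is compact.\<close>

lemma integral_config_measure:
  assumes "f \<in> compactly_supported_continuous" "\<omega> \<in> configurations"
  shows "(\<integral>x. f x \<partial>config_measure \<omega>) = (\<Sum>x | x \<in> \<omega> \<and> f x \<noteq> 0. f x)"
proof -
  have "f \<in> borel_measurable borel"
    using assms by (intro borel_measurable_continuous_onI) (simp add: compactly_supported_continuous_def)
  then have "(\<integral>x. f x \<partial>config_measure \<omega>) = (\<integral>x. f x \<partial>count_space \<omega>)"
    unfolding config_measure_def by (subst integral_distr) auto
  then show ?thesis
    using finite_support_in_configuration[OF assms]
    by (simp add: lebesgue_integral_count_space_finite_support)
qed

lemma integral_config_measure_mono:
  assumes "f \<in> compactly_supported_continuous" "g \<in> compactly_supported_continuous"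
    and "\<omega> \<in> configurations" "\<And>x. x \<in> \<omega> \<Longrightarrow> f x \<le> g x"
  shows "(\<integral>x. f x \<partial>config_measure \<omega>) \<le> (\<integral>x. g x \<partial>config_measure \<omega>)"
proof -
  let ?S = "{x \<in> \<omega>. f x \<noteq> 0} \<union> {x \<in> \<omega>. g x \<noteq> 0}"
  have fin: "finite ?S" using assms finite_support_in_configuration by blast
  have "(\<Sum>x | x \<in> \<omega> \<and> f x \<noteq> 0. f x) = (\<Sum>x\<in>?S. f x)"
    by (rule sum.mono_neutral_left[OF fin]) auto
  moreover have "(\<Sum>x | x \<in> \<omega> \<and> g x \<noteq> 0. g x) = (\<Sum>x\<in>?S. g x)"
    by (rule sum.mono_neutral_left[OF fin]) auto
  moreover have "(\<Sum>x\<in>?S. f x) \<le> (\<Sum>x\<in>?S. g x)"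
    using assms by (intro sum_mono) auto
  ultimately show ?thesis using assms by (simp add: integral_config_measure)
qed

lemma sets_config_algebra: "sets config_algebra = sigma_sets configurations {U. openin vague_topology U}"
proof -
  have "{U. openin vague_topology U} \<subseteq> Pow configurations"
    using openin_subset topspace_vague_topology by fastforce
  then show ?thesis unfolding config_algebra_def by (rule sets_measure_of)
qed

lemma borel_measurable_integral_config_measure:
  assumes "f \<in> compactly_supported_continuous"
  shows "(\<lambda>\<omega>. \<integral>x. f x \<partial>config_measure \<omega>) \<in> borel_measurable config_algebra"
proof (rule borel_measurableI)
  fix S :: "real set" assume "open S"
  then have "openin vague_topology {\<omega> \<in> configurations. (\<integral>x. f x \<partial>config_measure \<omega>) \<in> S}"
    using assms unfolding vague_topology_def by (intro topology_generated_by_Basis) blast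
  then have "{\<omega> \<in> configurations. (\<integral>x. f x \<partial>config_measure \<omega>) \<in> S} \<in> sets config_algebra"
    by (simp add: sets_config_algebra sigma_sets.Basic)
  also have "{\<omega> \<in> configurations. (\<integral>x. f x \<partial>config_measure \<omega>) \<in> S} =
      (\<lambda>\<omega>. \<integral>x. f x \<partial>config_measure \<omega>) -` S \<inter> space config_algebra"
    by (auto simp: space_config_algebra)
  finally show "(\<lambda>\<omega>. \<integral>x. f x \<partial>config_measure \<omega>) -` S \<inter> space config_algebra \<in> sets config_algebra" .
qed

text \<open>The points that some continuous function of compact support detects. In a locally compact
  space this is the whole space.\<close>

definition visible_region :: "'a::topological_space set" where
  "visible_region = (\<Union>f\<in>compactly_supported_continuous. {x. f x \<noteq> 0})"

lemma open_visible_region: "open (visible_region :: 'a::topological_space set)"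
  unfolding visible_region_def
  by (intro open_UN ballI open_Collect_neq)
     (auto simp: compactly_supported_continuous_def continuous_on_const)

text \<open>The integrals of the test functions, hence the generators of the vague topology, depend only on
  the part of the configuration inside the visible region, and this property passes to the generated
  topology and the generated \<open>\<sigma>\<close>-algebra.\<close>

lemma config_event_visible_cong:
  assumes "A \<in> sets (config_algebra :: 'a::topological_space set measure)"
    and \<omega>: "\<omega> \<in> configurations" "\<omega>' \<in> configurations" "\<omega> \<inter> visible_region = \<omega>' \<inter> visible_region"
  shows "\<omega> \<in> A \<longleftrightarrow> \<omega>' \<in> A"
  using assms(1) unfolding sets_config_algebra
proof (induction rule: sigma_sets.induct)
  case (Basic A)
  then have "generate_topology_on {{\<omega> \<in> configurations. (\<integral>x. f x \<partial>config_measure \<omega>) \<in> U} | f U.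
        f \<in> compactly_supported_continuous \<and> open U} A"
    by (simp add: vague_topology_def openin_topology_generated_by_iff)
  then show ?case
  proof induction
    case (Basis A)
    then obtain f U where A: "A = {\<omega> \<in> configurations. (\<integral>x. f x \<partial>config_measure \<omega>) \<in> U}"
      and f: "f \<in> compactly_supported_continuous" by blast
    have "{x. x \<in> \<omega> \<and> f x \<noteq> 0} = {x. x \<in> \<omega>' \<and> f x \<noteq> 0}"
      using \<omega>(3) f by (auto simp: visible_region_def)
    then show ?case using \<omega> f by (simp add: A integral_config_measure)
  qed auto
qed (use \<omega> in auto)

section \<open>Exhaustion by test functions\<close>

text \<open>Finitely many test functions have no common zero on \<open>L\<close>. The sum of their absolute values has
  a positive minimum there, and it is rescaled by that minimum and truncated at \<open>1\<close>.\<close>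

lemma compact_visible_cutoff:
  fixes L :: "'a::metric_space set"
  assumes "compact L" "L \<subseteq> visible_region"
  obtains g where "g \<in> compactly_supported_continuous" "\<And>x. 0 \<le> g x" "\<And>x. g x \<le> 1" "\<And>x. x \<in> L \<Longrightarrow> g x = 1"
proof -
  obtain F where F: "F \<subseteq> compactly_supported_continuous" "finite F" "L \<subseteq> (\<Union>f\<in>F. {x. f x \<noteq> 0})"
    using assms(1)
  proof (rule compactE_image)
    show "L \<subseteq> (\<Union>f\<in>compactly_supported_continuous. {x. f x \<noteq> 0})"
      using assms(2) by (simp add: visible_region_def)
    show "open {x. f x \<noteq> 0}" if "f \<in> compactly_supported_continuous" for f :: "'a \<Rightarrow> real"
      using that by (auto simp: compactly_supported_continuous_def intro: open_Collect_neq continuous_on_const)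
  qed blast
  define G where "G x = (\<Sum>f\<in>F. \<bar>f x\<bar>)" for x
  have contG: "continuous_on S G" for S
    unfolding G_def using F(1)
    by (intro continuous_intros) (auto simp: compactly_supported_continuous_def intro: continuous_on_subset)
  have posG: "0 < G x" if x: "x \<in> L" for x
  proof -
    obtain f where "f \<in> F" "f x \<noteq> 0" using F(3) x by blast
    then show ?thesis using F(2) unfolding G_def by (intro sum_pos2[of F f]) auto
  qed
  obtain c where c: "0 < c" "\<And>x. x \<in> L \<Longrightarrow> c \<le> G x"
  proof (cases "L = {}")
    case True
    then show ?thesis using that[of 1] by simp
  next
    case False
    then obtain x where "x \<in> L" "\<And>y. y \<in> L \<Longrightarrow> G x \<le> G y"
      using continuous_attains_inf[OF assms(1) _ contG] by blast
    then show ?thesis using that posG by blast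
  qed
  show ?thesis
  proof (rule that[of "\<lambda>x. min 1 (G x / c)"])
    show "(\<lambda>x. min 1 (G x / c)) \<in> compactly_supported_continuous"
    proof (rule compactly_supported_continuousI)
      show "continuous_on UNIV (\<lambda>x. min 1 (G x / c))"
        using c by (intro continuous_intros contG) auto
      show "compact (\<Union>f\<in>F. closure {x. f x \<noteq> 0})"
        using F by (intro compact_UN) (auto simp: compactly_supported_continuous_def)
      show "{x. min 1 (G x / c) \<noteq> 0} \<subseteq> (\<Union>f\<in>F. closure {x. f x \<noteq> 0})"
      proof
        fix x assume "x \<in> {x. min 1 (G x / c) \<noteq> 0}"
        then have "G x \<noteq> 0" by auto
        moreover have "G x = 0" if "\<forall>f\<in>F. f x = 0" 
          unfolding G_def by (intro sum.neutral) (use that in auto)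
        ultimately have "\<not> (\<forall>f\<in>F. f x = 0)" by auto
        then show "x \<in> (\<Union>f\<in>F. closure {x. f x \<noteq> 0})"
          by (auto intro!: subsetD[OF closure_subset])
      qed
    qed
    show "0 \<le> min 1 (G x / c)" for x using c by (simp add: G_def sum_nonneg)
    show "min 1 (G x / c) = 1" if "x \<in> L" for x using c(1) c(2)[OF that] by simp
  qed simp
qed

text \<open>An open subset of a \<open>\<sigma>\<close>-compact metric space is a union of compact sets \<open>L\<^sub>n\<close>. From cutoffs \<open>g\<^sub>n\<close>
  of \<open>L\<^sub>n\<close> the functions \<open>1 - \<Prod>i\<le>k. (1 - g\<^sub>i)\<close> increase with \<open>k\<close> and reach \<open>1\<close> as soon as one \<open>g\<^sub>i\<close>
  does.\<close>

lemma visible_region_exhaustion: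
  assumes "sigma_compact_space TYPE('a::metric_space)"
  obtains h :: "nat \<Rightarrow> 'a::metric_space \<Rightarrow> real"
  where "\<And>k. h k \<in> compactly_supported_continuous" "\<And>k x. 0 \<le> h k x" "\<And>k x. h k x \<le> 1"
    "\<And>x. incseq (\<lambda>k. h k x)" "\<And>k x. x \<notin> visible_region \<Longrightarrow> h k x = 0"
    "\<And>x. x \<in> visible_region \<Longrightarrow> \<exists>k. h k x = 1"
proof -
  obtain K :: "nat \<Rightarrow> 'a set" where K: "\<And>n. compact (K n)" "(\<Union>n. K n) = UNIV"
    using assms unfolding sigma_compact_space_def by blast
  have "fsigma_in euclidean (visible_region :: 'a set)"
    by (intro open_imp_fsigma_in metrizable_space_euclidean) (simp add: open_visible_region)
  then obtain C :: "nat \<Rightarrow> 'a set" where C: "\<And>n. closed (C n)" "\<And>n. C n \<subseteq> C (Suc n)" "\<Union> (range C) = visible_region"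
    unfolding fsigma_in_ascending by auto
  define L where "L n = (\<Union>i\<le>n. K i) \<inter> C n" for n
  have "\<exists>g. g \<in> compactly_supported_continuous \<and> (\<forall>x. 0 \<le> g x) \<and> (\<forall>x. g x \<le> 1) \<and> (\<forall>x\<in>L n. g x = 1)" for n
  proof -
    have "compact (L n)" unfolding L_def using K C by (intro compact_Int_closed compact_UN) auto
    moreover have "L n \<subseteq> visible_region" using C(3) by (auto simp: L_def)
    ultimately show ?thesis by (metis compact_visible_cutoff)
  qed
  then obtain g where g: "\<And>n. g n \<in> compactly_supported_continuous" "\<And>n x. 0 \<le> g n x" "\<And>n x. g n x \<le> 1"
      "\<And>n x. x \<in> L n \<Longrightarrow> g n x = 1" by metis
  define h where "h k x = 1 - (\<Prod>i\<le>k. 1 - g i x)" for k x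
  show ?thesis
  proof
    have prod: "0 \<le> (\<Prod>i\<le>k. 1 - g i x)" "(\<Prod>i\<le>k. 1 - g i x) \<le> 1" for k x
      using g by (auto intro!: prod_nonneg prod_le_1)
    then show "0 \<le> h k x" "h k x \<le> 1" for k x by (simp_all add: h_def)
    show "h k \<in> compactly_supported_continuous" for k
    proof (rule compactly_supported_continuousI)
      show "continuous_on UNIV (h k)"
        unfolding h_def using g(1) by (intro continuous_intros) (simp add: compactly_supported_continuous_def)
      show "compact (\<Union>i\<le>k. closure {x. g i x \<noteq> 0})"
        using g(1) by (intro compact_UN) (auto simp: compactly_supported_continuous_def)
      show "{x. h k x \<noteq> 0} \<subseteq> (\<Union>i\<le>k. closure {x. g i x \<noteq> 0})"
      proof
        fix x assume "x \<in> {x. h k x \<noteq> 0}"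
        moreover have "h k x = 0" if z: "\<forall>i\<le>k. g i x = 0"
        proof -
          have "(\<Prod>i\<le>k. 1 - g i x) = (\<Prod>i\<le>k. 1)" by (rule prod.cong) (use z in auto)
          then show ?thesis by (simp add: h_def)
        qed
        ultimately have "\<not> (\<forall>i\<le>k. g i x = 0)" by auto
        then show "x \<in> (\<Union>i\<le>k. closure {x. g i x \<noteq> 0})"
          by (auto intro!: subsetD[OF closure_subset])
      qed
    qed
    show "incseq (\<lambda>k. h k x)" for x
    proof (rule incseq_SucI)
      fix k
      have "(\<Prod>i\<le>k. 1 - g i x) * (1 - g (Suc k) x) \<le> (\<Prod>i\<le>k. 1 - g i x)"
        using prod(1)[of x k] g(2)[of "Suc k" x] g(3)[of "Suc k" x] by (intro mult_right_le_one_le) auto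
      then show "h k x \<le> h (Suc k) x" by (simp add: h_def)
    qed
    show "h k x = 0" if "x \<notin> visible_region" for k x
    proof -
      have "g i x = 0" for i using g(1)[of i] that by (auto simp: visible_region_def)
      then show ?thesis by (simp add: h_def)
    qed
    show "\<exists>k. h k x = 1" if x: "x \<in> visible_region" for x
    proof -
      obtain i where "x \<in> K i" using K(2) by blast
      moreover obtain j where "x \<in> C j" using C(3) x by blast
      then have "x \<in> C (max i j)" using C(2) lift_Suc_mono_le[of C j "max i j"] by auto
      ultimately have "x \<in> L (max i j)" by (auto simp: L_def)
      then have "h (max i j) x = 1" using g(4) by (auto simp: h_def intro!: prod_zero)
      then show ?thesis by blast
    qed
  qed
qed

section \<open>Total variation distance as a count\<close>

lemma total_variation_eq_count:
  fixes \<omega> \<eta> :: "'a::metric_space set"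
  shows "total_variation \<omega> \<eta> = emeasure (count_space UNIV) ((\<omega> - \<eta>) \<union> (\<eta> - \<omega>))"
proof -
  let ?D = "(\<omega> - \<eta>) \<union> (\<eta> - \<omega>)"
  have m: "measure (config_measure \<zeta>) {x} = indicator \<zeta> x" for \<zeta> and x :: 'a
  proof -
    have "measure (config_measure \<zeta>) {x} = measure (count_space \<zeta>) ({x} \<inter> \<zeta>)"
      unfolding config_measure_def by (subst measure_distr) auto
    then show ?thesis by (simp add: measure_def indicator_def)
  qed
  have "total_variation \<omega> \<eta> = (\<Sum>\<^sub>\<infinity>x\<in>UNIV. ennreal \<bar>indicator \<omega> x - indicator \<eta> x\<bar>)"
    by (simp add: total_variation_def m)
  also have "\<dots> = (\<Sum>\<^sub>\<infinity>x\<in>?D. 1)"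
    by (rule infsum_cong_neutral) (auto simp: indicator_def)
  also have "\<dots> = emeasure (count_space UNIV) ?D"
    by (cases "finite ?D") (auto simp: infsum_superconst_infinite_ennreal[where b=1])
  finally show ?thesis .
qed

section \<open>Visible points of a Poisson configuration\<close>

locale poisson_config =
  fixes \<sigma> :: "'a::metric_space measure" and \<mu> :: "'a set measure"
  assumes sigma_compact: "sigma_compact_space TYPE('a)"
    and sets_intensity: "sets \<sigma> = sets borel"
    and finite_intensity: "emeasure \<sigma> UNIV < \<infinity>"
    and diffuse_intensity: "diffuse \<sigma>"
    and poisson: "poisson_measure \<sigma> \<mu>"
begin

lemma prob_space_law: "prob_space \<mu>"
  using poisson by (simp add: poisson_measure_def)

lemma sets_law: "sets \<mu> = sets config_algebra"
  using poisson by (simp add: poisson_measure_def)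

lemma space_law: "space \<mu> = configurations"
  using sets_eq_imp_space_eq[OF sets_law] by (simp add: space_config_algebra)

lemma finite_measure_intensity: "finite_measure \<sigma>"
  using sets_eq_imp_space_eq[OF sets_intensity] finite_intensity
  by (intro finite_measureI) (simp add: less_top)

lemma measurable_linear_statistic:
  assumes "f \<in> compactly_supported_continuous"
  shows "(\<lambda>\<omega>. \<integral>x. f x \<partial>config_measure \<omega>) \<in> borel_measurable \<mu>"
  using borel_measurable_integral_config_measure[OF assms]
  by (subst measurable_cong_sets[OF sets_law refl])

text \<open>The Bochner integral of a non-integrable function is \<open>0\<close>, whereas the prescribed value is
  positive. Hence the exponential is integrable, and its Lebesgue integral has the same value.\<close>

lemma laplace_functional_nn:
  assumes f: "f \<in> compactly_supported_continuous"
  shows "(\<integral>\<^sup>+\<omega>. ennreal (exp (\<integral>x. f x \<partial>config_measure \<omega>)) \<partial>\<mu>) = ennreal (exp (\<integral>x. exp (f x) - 1 \<partial>\<sigma>))"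
proof -
  have eq: "(\<integral>\<omega>. exp (\<integral>x. f x \<partial>config_measure \<omega>) \<partial>\<mu>) = exp (\<integral>x. exp (f x) - 1 \<partial>\<sigma>)"
    using poisson f by (simp add: poisson_measure_def)
  then have "integrable \<mu> (\<lambda>\<omega>. exp (\<integral>x. f x \<partial>config_measure \<omega>))"
    using not_integrable_integral_eq[of \<mu> "\<lambda>\<omega>. exp (\<integral>x. f x \<partial>config_measure \<omega>)"] by fastforce
  then show ?thesis by (subst nn_integral_eq_integral) (auto simp: eq)
qed

text \<open>Test functions \<open>g\<^sub>j\<close> with \<open>g\<^sub>j x = 1\<close> decrease to the indicator of \<open>{x}\<close>. On the event that every
  integral of \<open>g\<^sub>j\<close> is at least \<open>1\<close>, which contains all configurations through \<open>x\<close>, their exponentials are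
  at least \<open>2\<close>, so the probability \<open>p\<close> of the event satisfies \<open>1 + p \<le> exp (\<integral>(exp g\<^sub>j - 1) d\<sigma>)\<close>. The
  right-hand side tends to \<open>1\<close> because \<open>\<sigma>\<close> does not charge \<open>x\<close>.\<close>

lemma AE_not_in_config:
  assumes x: "x \<in> visible_region"
  shows "AE \<omega> in \<mu>. x \<notin> \<omega>"
proof -
  interpret prob_space \<mu> by (rule prob_space_law)
  interpret \<sigma>: finite_measure \<sigma> by (rule finite_measure_intensity)
  obtain f :: "'a \<Rightarrow> real" where f: "f \<in> compactly_supported_continuous" "f x \<noteq> 0"
    using x by (auto simp: visible_region_def)
  define g where "g j y = min 1 \<bar>f y / f x\<bar> * max 0 (1 - real j * dist x y)" for j y
  have g01: "0 \<le> g j y" "g j y \<le> 1" for j y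
    by (auto simp: g_def intro!: mult_le_one)
  have gx: "g j x = 1" for j using f by (simp add: g_def)
  have contg: "continuous_on UNIV (g j)" for j
    unfolding g_def using f by (intro continuous_intros) (auto simp: compactly_supported_continuous_def)
  have g: "g j \<in> compactly_supported_continuous" for j
  proof (rule compactly_supported_continuousI[OF contg])
    show "compact (closure {x. f x \<noteq> 0})" using f by (simp add: compactly_supported_continuous_def)
    show "{y. g j y \<noteq> 0} \<subseteq> closure {x. f x \<noteq> 0}"
      by (auto simp: g_def intro!: subsetD[OF closure_subset])
  qed
  define S where "S j \<omega> = (\<integral>y. g j y \<partial>config_measure \<omega>)" for j \<omega>
  have S_meas [measurable]: "S j \<in> borel_measurable \<mu>" for j
    unfolding S_def by (rule measurable_linear_statistic[OF g])
  define N where "N = {\<omega> \<in> space \<mu>. \<forall>j. 1 \<le> S j \<omega>}"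
  have N [measurable]: "N \<in> sets \<mu>" unfolding N_def by measurable
  have "emeasure \<mu> N = 0"
  proof -
    have bound: "1 + prob N \<le> exp (\<integral>y. exp (g j y) - 1 \<partial>\<sigma>)" for j
    proof -
      have "ennreal (1 + prob N) = (\<integral>\<^sup>+\<omega>. 1 + indicator N \<omega> \<partial>\<mu>)"
        by (subst nn_integral_add) (auto simp: emeasure_space_1 ennreal_plus simp flip: emeasure_eq_measure)
      also have "\<dots> \<le> (\<integral>\<^sup>+\<omega>. ennreal (exp (S j \<omega>)) \<partial>\<mu>)"
      proof (rule nn_integral_mono)
        fix \<omega> assume \<omega>: "\<omega> \<in> space \<mu>"
        have "0 \<le> S j \<omega>"
          using \<omega> g01 unfolding S_def by (intro Bochner_Integration.integral_nonneg) auto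
        moreover have "1 + S j \<omega> \<le> exp (S j \<omega>)" by simp
        ultimately have "1 + indicator N \<omega> \<le> exp (S j \<omega>)" 
          by (auto simp: indicator_def N_def intro: order_trans[of 2 "1 + S j \<omega>"])
        then have "ennreal (1 + indicator N \<omega>) \<le> ennreal (exp (S j \<omega>))" by (rule ennreal_leI)
        then show "1 + indicator N \<omega> \<le> ennreal (exp (S j \<omega>))"
          by (auto simp: indicator_def split: if_splits)
      qed
      also have "\<dots> = ennreal (exp (\<integral>y. exp (g j y) - 1 \<partial>\<sigma>))"
        unfolding S_def by (rule laplace_functional_nn[OF g])
      finally show ?thesis by (subst (asm) ennreal_le_iff) auto
    qed
    have "(\<lambda>j. \<integral>y. exp (g j y) - 1 \<partial>\<sigma>) \<longlonglongrightarrow> (\<integral>y. 0 \<partial>\<sigma>)"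
    proof (rule integral_dominated_convergence[where w = "\<lambda>_. exp 1"])
      show "(\<lambda>y. exp (g j y) - 1) \<in> borel_measurable \<sigma>" for j
        unfolding measurable_cong_sets[OF sets_intensity refl]
        by (intro borel_measurable_continuous_onI continuous_intros contg)
      have "AE y in \<sigma>. y \<noteq> x"
        using diffuse_intensity sets_intensity
        by (intro AE_I'[of "{x}"]) (auto simp: diffuse_def null_sets_def)
      then show "AE y in \<sigma>. (\<lambda>j. exp (g j y) - 1) \<longlonglongrightarrow> 0"
      proof eventually_elim
        case (elim y)
        then obtain n where n: "1 < real n * dist x y"
          using reals_Archimedean3[of "dist x y"] by auto
        have "g j y = 0" if "n \<le> j" for j
        proof -
          have "real n * dist x y \<le> real j * dist x y" using that by (intro mult_right_mono) auto
          then show ?thesis using n by (simp add: g_def)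
        qed
        then have "\<forall>\<^sub>F j in sequentially. exp (g j y) - 1 = 0"
          by (auto simp: eventually_sequentially)
        then show ?case by (rule tendsto_eventually)
      qed
      show "AE y in \<sigma>. norm (exp (g j y) - 1) \<le> exp 1" for j
      proof (rule AE_I2)
        fix y
        have "1 \<le> exp (g j y)" "exp (g j y) \<le> exp 1"
          using g01[of j y] by (simp_all only: one_le_exp_iff exp_le_cancel_iff)
        then show "norm (exp (g j y) - 1) \<le> exp 1" unfolding real_norm_def by linarith
      qed
    qed auto
    then have "(\<lambda>j. exp (\<integral>y. exp (g j y) - 1 \<partial>\<sigma>)) \<longlonglongrightarrow> exp 0"
      by (intro tendsto_exp) simp
    then have "1 + prob N \<le> exp 0"
      using bound by (intro LIMSEQ_le_const) auto
    then show ?thesis by (simp add: emeasure_eq_measure measure_le_0_iff)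
  qed
  then have "N \<in> null_sets \<mu>" using N by (simp add: null_sets_def)
  moreover have "{\<omega> \<in> space \<mu>. \<not> x \<notin> \<omega>} \<subseteq> N"
  proof
    fix \<omega> assume \<omega>: "\<omega> \<in> {\<omega> \<in> space \<mu>. \<not> x \<notin> \<omega>}"
    have "1 \<le> S j \<omega>" for j
    proof -
      have \<omega>c: "\<omega> \<in> configurations" and x\<omega>: "x \<in> \<omega>" using \<omega> by (auto simp: space_law)
      have "g j x \<le> (\<Sum>y | y \<in> \<omega> \<and> g j y \<noteq> 0. g j y)"
        using finite_support_in_configuration[OF g \<omega>c] x\<omega> gx g01
        by (intro member_le_sum) auto
      then show ?thesis using gx by (simp add: S_def integral_config_measure[OF g \<omega>c])
    qed
    then show "\<omega> \<in> N" using \<omega> by (simp add: N_def)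
  qed
  ultimately show ?thesis by (intro AE_I')
qed

abbreviation visible_count :: "'a set \<Rightarrow> nat" where
  "visible_count \<omega> \<equiv> card (\<omega> \<inter> visible_region)"

abbreviation visible_mass :: real where
  "visible_mass \<equiv> measure \<sigma> visible_region"

text \<open>Integrals of an exhausting sequence of test functions make the number of visible points a limit
  of random variables whose exponential moments the Poisson property prescribes.\<close>

lemma linear_statistics_increase_to_count:
  obtains h :: "nat \<Rightarrow> 'a \<Rightarrow> real" where
    "\<And>k. h k \<in> compactly_supported_continuous" "\<And>k x. 0 \<le> h k x" "\<And>k x. h k x \<le> 1"
    "\<And>x. (\<lambda>k. h k x) \<longlonglongrightarrow> indicator visible_region x"
    "\<And>\<omega>. \<omega> \<in> configurations \<Longrightarrow> incseq (\<lambda>k. \<integral>x. h k x \<partial>config_measure \<omega>)"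
    "\<And>\<omega>. \<omega> \<in> configurations \<Longrightarrow>
      (SUP k. ennreal (\<integral>x. h k x \<partial>config_measure \<omega>)) = emeasure (count_space UNIV) (\<omega> \<inter> visible_region)"
proof -
  obtain h :: "nat \<Rightarrow> 'a \<Rightarrow> real" where
    h: "\<And>k. h k \<in> compactly_supported_continuous" "\<And>k x. 0 \<le> h k x" "\<And>k x. h k x \<le> 1"
    and inc: "\<And>x. incseq (\<lambda>k. h k x)" and out: "\<And>k x. x \<notin> visible_region \<Longrightarrow> h k x = 0"
    and full: "\<And>x. x \<in> visible_region \<Longrightarrow> \<exists>k. h k x = 1"
    using visible_region_exhaustion[OF sigma_compact] by metis
  have lim: "(\<lambda>k. h k x) \<longlonglongrightarrow> indicator visible_region x" for x
  proof (cases "x \<in> visible_region")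
    case True
    then obtain n where "h n x = 1" using full by blast
    then have "h k x = 1" if "n \<le> k" for k
      using incseqD[OF inc that, of x] h(3)[of k x] by simp
    then have "\<forall>\<^sub>F k in sequentially. h k x = 1" by (auto simp: eventually_sequentially)
    then show ?thesis using True by (simp add: tendsto_eventually)
  qed (simp add: out)
  show ?thesis
  proof (rule that[OF h lim])
    fix \<omega> :: "'a set" assume \<omega>: "\<omega> \<in> configurations"
    show "incseq (\<lambda>k. \<integral>x. h k x \<partial>config_measure \<omega>)"
      by (rule incseq_SucI, rule integral_config_measure_mono[OF h(1) h(1) \<omega>]) (rule incseq_SucD[OF inc])
    have "ennreal (\<integral>x. h k x \<partial>config_measure \<omega>) = (\<integral>\<^sup>+x. ennreal (h k x) \<partial>count_space \<omega>)" for k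
    proof -
      have "{x \<in> \<omega>. 0 < ennreal (h k x)} = {x \<in> \<omega>. h k x \<noteq> 0}"
        using h(2) by (auto simp: less_le)
      then show ?thesis
        using finite_support_in_configuration[OF h(1) \<omega>, of k] h(2)
        by (subst nn_integral_count_space) (auto simp: integral_config_measure[OF h(1) \<omega>] sum_ennreal)
    qed
    then have "(SUP k. ennreal (\<integral>x. h k x \<partial>config_measure \<omega>)) = (SUP k. \<integral>\<^sup>+x. ennreal (h k x) \<partial>count_space \<omega>)"
      by simp
    also have "\<dots> = (\<integral>\<^sup>+x. (SUP k. ennreal (h k x)) \<partial>count_space \<omega>)"
      using inc by (intro nn_integral_monotone_convergence_SUP[symmetric])
        (auto simp: incseq_def le_fun_def ennreal_leI)
    also have "\<dots> = (\<integral>\<^sup>+x. indicator (\<omega> \<inter> visible_region) x \<partial>count_space \<omega>)"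
    proof (rule nn_integral_cong)
      fix x assume "x \<in> space (count_space \<omega>)"
      have "(\<lambda>k. ennreal (h k x)) \<longlonglongrightarrow> (SUP k. ennreal (h k x))"
        using inc by (intro LIMSEQ_SUP) (auto simp: incseq_def ennreal_leI)
      moreover have "(\<lambda>k. ennreal (h k x)) \<longlonglongrightarrow> ennreal (indicator visible_region x)"
        by (intro tendsto_ennrealI lim)
      ultimately have "(SUP k. ennreal (h k x)) = ennreal (indicator visible_region x)"
        by (rule LIMSEQ_unique)
      then show "(SUP k. ennreal (h k x)) = indicator (\<omega> \<inter> visible_region) x"
        using \<open>x \<in> space (count_space \<omega>)\<close> by (simp add: indicator_def)
    qed
    also have "\<dots> = emeasure (count_space \<omega>) (\<omega> \<inter> visible_region)"
      by (rule nn_integral_indicator) auto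
    also have "\<dots> = emeasure (count_space UNIV) (\<omega> \<inter> visible_region)"
      by (simp add: emeasure_count_space)
    finally show "(SUP k. ennreal (\<integral>x. h k x \<partial>config_measure \<omega>)) = emeasure (count_space UNIV) (\<omega> \<inter> visible_region)" .
  qed
qed

lemma visible_count_measurable: "visible_count \<in> measurable \<mu> (count_space UNIV)"
proof -
  obtain h :: "nat \<Rightarrow> 'a \<Rightarrow> real" where h: "\<And>k. h k \<in> compactly_supported_continuous"
    and sup: "\<And>\<omega>. \<omega> \<in> configurations \<Longrightarrow>
      (SUP k. ennreal (\<integral>x. h k x \<partial>config_measure \<omega>)) = emeasure (count_space UNIV) (\<omega> \<inter> visible_region)"
    using linear_statistics_increase_to_count by metis
  have [measurable]: "(\<lambda>\<omega>. \<integral>x. h k x \<partial>config_measure \<omega>) \<in> borel_measurable \<mu>" for k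
    by (rule measurable_linear_statistic[OF h])
  have "real (visible_count \<omega>) = enn2real (SUP k. ennreal (\<integral>x. h k x \<partial>config_measure \<omega>))"
    if "\<omega> \<in> space \<mu>" for \<omega>
    using that by (cases "finite (\<omega> \<inter> visible_region)") (auto simp: sup space_law)
  then have "(\<lambda>\<omega>. real (visible_count \<omega>)) \<in> borel_measurable \<mu>"
    by (subst measurable_cong) (assumption, measurable)
  then have "(\<lambda>\<omega>. nat \<lfloor>real (visible_count \<omega>)\<rfloor>) \<in> measurable \<mu> (count_space UNIV)"
    by measurable
  then show ?thesis by simp
qed

text \<open>For \<open>exp \<tau> = 1 + u\<close> and test functions \<open>h\<^sub>k\<close> increasing to the indicator of the visible region, the
  Poisson property with \<open>f = \<tau> h\<^sub>k\<close> yields the generating function in the limit: by monotone convergence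
  on the side of configurations, by dominated convergence on the side of the intensity. Finiteness of
  the limit for \<open>\<tau> = 1\<close> excludes infinitely many visible points.\<close>

lemma visible_count_gf_and_AE_finite:
  shows "AE \<omega> in \<mu>. finite (\<omega> \<inter> visible_region)"
    and "0 < u \<Longrightarrow> (\<integral>\<^sup>+\<omega>. ennreal ((1 + u) ^ visible_count \<omega>) \<partial>\<mu>) = ennreal (exp (visible_mass * u))"
proof -
  interpret \<sigma>: finite_measure \<sigma> by (rule finite_measure_intensity)
  obtain h :: "nat \<Rightarrow> 'a \<Rightarrow> real" where
    h: "\<And>k. h k \<in> compactly_supported_continuous" "\<And>k x. 0 \<le> h k x" "\<And>k x. h k x \<le> 1"
    and lim: "\<And>x. (\<lambda>k. h k x) \<longlonglongrightarrow> indicator visible_region x"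
    and inc: "\<And>\<omega>. \<omega> \<in> configurations \<Longrightarrow> incseq (\<lambda>k. \<integral>x. h k x \<partial>config_measure \<omega>)"
    and sup: "\<And>\<omega>. \<omega> \<in> configurations \<Longrightarrow>
      (SUP k. ennreal (\<integral>x. h k x \<partial>config_measure \<omega>)) = emeasure (count_space UNIV) (\<omega> \<inter> visible_region)"
    using linear_statistics_increase_to_count by metis
  define S where "S k \<omega> = (\<integral>x. h k x \<partial>config_measure \<omega>)" for k \<omega>
  have S_meas [measurable]: "S k \<in> borel_measurable \<mu>" for k
    unfolding S_def by (rule measurable_linear_statistic[OF h(1)])
  have V [measurable]: "visible_region \<in> sets \<sigma>"
    by (simp add: sets_intensity open_visible_region)
  have exp_sup: "(\<integral>\<^sup>+\<omega>. (SUP k. ennreal (exp (ln (1 + u) * S k \<omega>))) \<partial>\<mu>) = ennreal (exp (visible_mass * u))"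
    if u: "0 < u" for u
  proof -
    define t where "t = ln (1 + u)"
    have t: "0 \<le> t" "exp t = 1 + u" using u by (auto simp: t_def)
    have mono: "(\<integral>\<^sup>+\<omega>. (SUP k. ennreal (exp (t * S k \<omega>))) \<partial>\<mu>) = (SUP k. \<integral>\<^sup>+\<omega>. ennreal (exp (t * S k \<omega>)) \<partial>\<mu>)"
    proof (rule nn_integral_monotone_convergence_SUP_AE)
      show "AE \<omega> in \<mu>. ennreal (exp (t * S k \<omega>)) \<le> ennreal (exp (t * S (Suc k) \<omega>))" for k
        using inc t(1) by (intro AE_I2 ennreal_leI)
          (auto simp: S_def space_law incseq_Suc_iff intro!: mult_left_mono)
    qed measurable
    have to_sup: "(\<lambda>k. \<integral>\<^sup>+\<omega>. ennreal (exp (t * S k \<omega>)) \<partial>\<mu>) \<longlonglongrightarrow> (SUP k. \<integral>\<^sup>+\<omega>. ennreal (exp (t * S k \<omega>)) \<partial>\<mu>)"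
      using inc t(1) by (intro LIMSEQ_SUP incseq_SucI nn_integral_mono ennreal_leI)
        (auto simp: S_def space_law incseq_Suc_iff intro!: mult_left_mono)
    have laplace: "(\<integral>\<^sup>+\<omega>. ennreal (exp (t * S k \<omega>)) \<partial>\<mu>) = ennreal (exp (\<integral>x. exp (t * h k x) - 1 \<partial>\<sigma>))" for k
      using laplace_functional_nn[OF compactly_supported_continuous_scaled[OF h(1)]] by (simp add: S_def)
    have "(\<lambda>k. ennreal (exp (\<integral>x. exp (t * h k x) - 1 \<partial>\<sigma>))) \<longlonglongrightarrow> ennreal (exp (visible_mass * u))"
    proof (intro tendsto_ennrealI tendsto_exp)
      have "(\<lambda>k. \<integral>x. exp (t * h k x) - 1 \<partial>\<sigma>) \<longlonglongrightarrow> (\<integral>x. u * indicator visible_region x \<partial>\<sigma>)"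
      proof (rule integral_dominated_convergence[where w = "\<lambda>_. u"])
        show "(\<lambda>x. exp (t * h k x) - 1) \<in> borel_measurable \<sigma>" for k
          unfolding measurable_cong_sets[OF sets_intensity refl]
          using h(1)[of k] by (intro borel_measurable_continuous_onI continuous_intros)
            (simp add: compactly_supported_continuous_def)
        show "AE x in \<sigma>. (\<lambda>k. exp (t * h k x) - 1) \<longlonglongrightarrow> u * indicator visible_region x"
        proof (rule AE_I2)
          fix x
          have "(\<lambda>k. exp (t * h k x) - 1) \<longlonglongrightarrow> exp (t * indicator visible_region x) - 1"
            by (intro tendsto_intros lim)
          then show "(\<lambda>k. exp (t * h k x) - 1) \<longlonglongrightarrow> u * indicator visible_region x"
            using t(2) by (auto simp: indicator_def split: if_splits)
        qed
        show "AE x in \<sigma>. norm (exp (t * h k x) - 1) \<le> u" for k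
        proof (rule AE_I2)
          fix x
          have "exp (t * h k x) \<le> exp t" using t(1) h(2,3) by (simp add: mult_left_le)
          moreover have "1 \<le> exp (t * h k x)" using t(1) h(2) by simp
          ultimately show "norm (exp (t * h k x) - 1) \<le> u" using t(2) by simp
        qed
      qed auto
      then show "(\<lambda>k. \<integral>x. exp (t * h k x) - 1 \<partial>\<sigma>) \<longlonglongrightarrow> visible_mass * u"
        by (simp add: mult.commute)
    qed
    then have "(\<lambda>k. \<integral>\<^sup>+\<omega>. ennreal (exp (t * S k \<omega>)) \<partial>\<mu>) \<longlonglongrightarrow> ennreal (exp (visible_mass * u))"
      by (simp only: laplace)
    from LIMSEQ_unique[OF to_sup this] mono show ?thesis by (simp add: t_def)
  qed
  have "(\<integral>\<^sup>+\<omega>. (SUP k. ennreal (exp (S k \<omega>))) \<partial>\<mu>) \<noteq> \<infinity>"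
    using exp_sup[of "exp 1 - 1"] by simp
  then have "AE \<omega> in \<mu>. (SUP k. ennreal (exp (S k \<omega>))) \<noteq> \<infinity>"
    by (intro nn_integral_noteq_infinite) measurable
  then show fin: "AE \<omega> in \<mu>. finite (\<omega> \<inter> visible_region)"
  proof (rule AE_mp, intro AE_I2 impI)
    fix \<omega> assume \<omega>: "\<omega> \<in> space \<mu>" and *: "(SUP k. ennreal (exp (S k \<omega>))) \<noteq> \<infinity>"
    have "S k \<omega> \<le> exp (S k \<omega>)" for k
      using exp_ge_add_one_self[of "S k \<omega>"] by linarith
    then have "(SUP k. ennreal (S k \<omega>)) \<le> (SUP k. ennreal (exp (S k \<omega>)))"
      by (intro SUP_mono' ennreal_leI)
    then have "emeasure (count_space UNIV) (\<omega> \<inter> visible_region) \<le> (SUP k. ennreal (exp (S k \<omega>)))"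
      using sup[of \<omega>] \<omega> by (simp add: S_def space_law)
    then have "emeasure (count_space UNIV) (\<omega> \<inter> visible_region) \<noteq> \<infinity>"
      using * by (metis infinity_ennreal_def top_unique)
    then show "finite (\<omega> \<inter> visible_region)" by (auto simp: emeasure_count_space split: if_splits)
  qed
  assume u: "0 < u"
  show "(\<integral>\<^sup>+\<omega>. ennreal ((1 + u) ^ visible_count \<omega>) \<partial>\<mu>) = ennreal (exp (visible_mass * u))"
    unfolding exp_sup[OF u, symmetric]
  proof (rule nn_integral_cong_AE, use fin in \<open>rule AE_mp, intro AE_I2 impI\<close>)
    fix \<omega> assume "\<omega> \<in> space \<mu>" and fin\<omega>: "finite (\<omega> \<inter> visible_region)"
    then have \<omega>: "\<omega> \<in> configurations" by (simp add: space_law)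
    have "(\<lambda>k. ennreal (S k \<omega>)) \<longlonglongrightarrow> (SUP k. ennreal (S k \<omega>))"
      using inc[OF \<omega>] by (intro LIMSEQ_SUP) (auto simp: incseq_def ennreal_leI S_def)
    also have "(SUP k. ennreal (S k \<omega>)) = ennreal (real (visible_count \<omega>))"
      using sup[OF \<omega>] fin\<omega> by (simp add: S_def ennreal_of_nat_eq_real_of_nat)
    finally have "(\<lambda>k. S k \<omega>) \<longlonglongrightarrow> real (visible_count \<omega>)"
      using h(2) by (subst (asm) tendsto_ennreal_iff) (auto simp: S_def)
    then have "(\<lambda>k. ennreal (exp (ln (1 + u) * S k \<omega>))) \<longlonglongrightarrow> ennreal (exp (ln (1 + u) * real (visible_count \<omega>)))"
      by (intro tendsto_intros tendsto_ennrealI)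
    moreover have "(\<lambda>k. ennreal (exp (ln (1 + u) * S k \<omega>))) \<longlonglongrightarrow> (SUP k. ennreal (exp (ln (1 + u) * S k \<omega>)))"
      using inc[OF \<omega>] u by (intro LIMSEQ_SUP incseq_SucI ennreal_leI)
        (auto simp: incseq_Suc_iff S_def intro!: mult_left_mono)
    ultimately have "(SUP k. ennreal (exp (ln (1 + u) * S k \<omega>))) = ennreal (exp (ln (1 + u) * real (visible_count \<omega>)))"
      by (rule LIMSEQ_unique[rotated])
    then show "ennreal ((1 + u) ^ visible_count \<omega>) = (SUP k. ennreal (exp (ln (1 + u) * S k \<omega>)))"
      using u by (simp add: mult.commute[of "ln (1 + u)"] exp_of_nat_mult)
  qed
qed

end

section \<open>Deviation of the total variation distance\<close>

theorem proposition4p6: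
  fixes \<sigma> :: "'a::metric_space measure" and \<mu> :: "'a set measure"
    and \<eta> :: "'a set" and r :: real
  assumes "sigma_compact_space TYPE('a)"
    and "radon_measure \<sigma>"
    and "diffuse \<sigma>"
    and "poisson_measure \<sigma> \<mu>"
    and "\<eta> \<in> configurations"
    and "emeasure \<sigma> UNIV < \<infinity>"
    and "(\<integral>\<^sup>+\<omega>. total_variation \<omega> \<eta> \<partial>\<mu>) < \<infinity>"
    and "r > 0"
  shows "let s = measure \<sigma> UNIV; m = upper_int s; n = upper_int (s + r) in
     measure \<mu> {\<omega> \<in> space \<mu>. total_variation \<omega> \<eta> \<ge> (\<integral>\<^sup>+\<omega>. total_variation \<omega> \<eta> \<partial>\<mu>) + ennreal r}
     \<le> (sqrt (2 * pi * real m) * real m ^ m * exp (1 / (12 * real m))) / (s powr s) *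
       (exp (real n - real m - real n * ln (real n / (real n - r))) / sqrt (2 * pi * real n))"
proof -
  interpret poisson_config \<sigma> \<mu>
    using assms by unfold_locales (auto simp: radon_measure_def)
  interpret prob_space \<mu> by (rule prob_space_law)
  interpret \<sigma>: finite_measure \<sigma> by (rule finite_measure_intensity)
  define c where "c = emeasure (count_space UNIV) (\<eta> \<inter> visible_region)"
  define E where "E = (\<integral>\<^sup>+\<omega>. total_variation \<omega> \<eta> \<partial>\<mu>)"
  define A where "A = {\<omega> \<in> space \<mu>. E + ennreal r \<le> total_variation \<omega> \<eta>}"
  define k where "k = nat \<lceil>visible_mass + r\<rceil>"
  note [measurable] = visible_count_measurable
  have mass: "0 \<le> visible_mass" "visible_mass \<le> measure \<sigma> UNIV"
    by (auto intro!: \<sigma>.finite_measure_mono simp: sets_intensity)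
  have "countable (\<eta> \<inter> visible_region)"
  proof -
    obtain K :: "nat \<Rightarrow> 'a set" where "\<And>n. compact (K n)" "(\<Union>n. K n) = UNIV"
      using assms(1) unfolding sigma_compact_space_def by blast
    then have "\<And>n. finite (\<eta> \<inter> K n)" "\<eta> = (\<Union>n. \<eta> \<inter> K n)"
      using assms(5) by (auto simp: configurations_def)
    then have "countable \<eta>" by (metis countable_UN countable_finite countableI_type)
    then show ?thesis by (rule countable_subset[rotated]) auto
  qed
  then have "AE \<omega> in \<mu>. \<forall>x\<in>\<eta> \<inter> visible_region. x \<notin> \<omega>"
    using AE_not_in_config by (subst AE_ball_countable) auto
  \<comment> \<open>The count is written as \<open>N choose 1\<close>, so its mean is the factorial moment of order one.\<close>
  then have "AE \<omega> in \<mu>. ennreal (real (visible_count \<omega> choose 1)) + c \<le> total_variation \<omega> \<eta>"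
    using visible_count_gf_and_AE_finite(1)
  proof eventually_elim
    case (elim \<omega>)
    have "ennreal (real (visible_count \<omega> choose 1)) + c =
        emeasure (count_space UNIV) ((\<omega> \<inter> visible_region) \<union> (\<eta> \<inter> visible_region))"
      using elim unfolding c_def
      by (subst plus_emeasure[symmetric]) (auto simp: ennreal_of_nat_eq_real_of_nat)
    also have "\<dots> \<le> total_variation \<omega> \<eta>"
      unfolding total_variation_eq_count using elim by (intro emeasure_mono) auto
    finally show ?case .
  qed
  then have "(\<integral>\<^sup>+\<omega>. ennreal (real (visible_count \<omega> choose 1)) + c \<partial>\<mu>) \<le> E"
    unfolding E_def by (rule nn_integral_mono_AE)
  moreover have "(\<integral>\<^sup>+\<omega>. ennreal (real (visible_count \<omega> choose 1)) \<partial>\<mu>) = ennreal (visible_mass ^ 1 / fact 1)"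
    by (rule poisson_factorial_moment[OF visible_count_measurable visible_count_gf_and_AE_finite(2)])
  ultimately have mean: "ennreal visible_mass + c \<le> E"
    by (simp add: nn_integral_add emeasure_space_1)
  \<comment> \<open>Finiteness of the mean leaves only finitely many visible points of \<open>\<eta>\<close>, so \<open>c\<close> can be cancelled below.\<close>
  have c: "c \<noteq> \<infinity>" using mean assms(7) by (auto simp: E_def top_unique)
  have sub: "AE \<omega> in \<mu>. \<omega> \<in> A \<longrightarrow> \<omega> \<in> {\<omega> \<in> space \<mu>. k \<le> visible_count \<omega>}" if A: "A \<in> sets \<mu>"
    using visible_count_gf_and_AE_finite(1)
  proof (rule AE_mp, intro AE_I2 impI)
    fix \<omega> assume \<omega>: "\<omega> \<in> space \<mu>" "\<omega> \<in> A" and fin: "finite (\<omega> \<inter> visible_region)"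
    \<comment> \<open>The visible part of \<open>\<omega>\<close>, completed by \<open>\<eta>\<close> outside, where it then adds nothing to the distance to \<open>\<eta>\<close>.\<close>
    define \<omega>' where "\<omega>' = (\<omega> \<inter> visible_region) \<union> (\<eta> - visible_region)"
    have "\<omega>' \<in> configurations"
    proof -
      have "finite (\<omega>' \<inter> K)" if "compact K" for K
      proof (rule finite_subset)
        show "finite ((\<omega> \<inter> K) \<union> (\<eta> \<inter> K))"
          using \<omega> assms(5) that by (auto simp: space_law configurations_def)
      qed (auto simp: \<omega>'_def)
      then show ?thesis by (simp add: configurations_def)
    qed
    moreover have "\<omega> \<inter> visible_region = \<omega>' \<inter> visible_region" by (auto simp: \<omega>'_def)
    ultimately have "\<omega>' \<in> A"
      using config_event_visible_cong[of A \<omega> \<omega>'] A \<omega> by (simp add: sets_law space_law)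
    then have "ennreal visible_mass + c + ennreal r \<le> total_variation \<omega>' \<eta>"
      using mean by (auto simp: A_def intro: order_trans add_right_mono)
    also have "\<dots> \<le> emeasure (count_space UNIV) ((\<omega> \<inter> visible_region) \<union> (\<eta> \<inter> visible_region))"
      unfolding total_variation_eq_count by (intro emeasure_mono) (auto simp: \<omega>'_def)
    also have "\<dots> \<le> emeasure (count_space UNIV) (\<omega> \<inter> visible_region) + c"
      unfolding c_def by (rule emeasure_subadditive) auto
    also have "\<dots> = ennreal (real (visible_count \<omega>)) + c"
      using fin by (simp add: ennreal_of_nat_eq_real_of_nat)
    finally have "c + ennreal (visible_mass + r) \<le> c + ennreal (real (visible_count \<omega>))"
      using assms(8) by (simp add: ennreal_plus add_ac)
    then have "visible_mass + r \<le> real (visible_count \<omega>)"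
      using c by (simp add: ennreal_add_left_cancel_le ennreal_le_iff)
    then show "\<omega> \<in> {\<omega> \<in> space \<mu>. k \<le> visible_count \<omega>}"
      using \<omega> by (simp add: k_def nat_le_iff ceiling_le_iff)
  qed
  \<comment> \<open>If the event is not measurable, its measure is \<open>0\<close> by convention.\<close>
  have le: "prob A \<le> prob {\<omega> \<in> space \<mu>. k \<le> visible_count \<omega>}"
  proof (cases "A \<in> sets \<mu>")
    case True
    then show ?thesis using sub by (intro finite_measure_mono_AE) auto
  qed (simp add: measure_notin_sets)
  have "prob A \<le> visible_mass ^ d / (fact d * real (k choose d))" if "d \<le> k" for d
    using le poisson_tail_le_factorial_moment[OF prob_space_law visible_count_measurable
        visible_count_gf_and_AE_finite(2) mass(1) that]
    by linarith
  from poisson_moment_bound_le_stirling_bound[OF mass assms(8) k_def this]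
  show ?thesis by (simp add: Let_def A_def E_def)
qed

end
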